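(* Let $G$ be a graph and let $L(G)$ be the line graph of $G$. Then the permanental nullity $\eta_{per}(L(G))$ equals zero or one.
   Context: All graphs are finite and simple. The line graph $L(G)$ of a graph $G$ has vertex set $E(G)$, two vertices of $L(G)$ being adjacent if and only if the corresponding edges of $G$ are adjacent (share an endpoint). For a graph $H$ with $n$ vertices and adjacency matrix $A(H)$, the permanental polynomial is $\pi(H,x)=\mathrm{per}(xI-A(H))$, where for an $n\times n$ matrix $A=(a_{ij})$, $\mathrm{per}(A)=\sum_{\sigma}\prod_{i=1}^n a_{i\sigma(i)}$ with $\sigma$ ranging over all permutations of $\{1,\dots,n\}$. The permanental nullity (per-nullity) $\eta_{per}(H)$ is the multiplicity of $0$ as a root of $\pi(H,x)$ (it is $0$ if $0$ is not a root).
   Formalization: The graph G is additionally assumed to be connected; without this the claim fails, e.g. for two disjoint edges, whose line graph is two isolated vertices with permanental polynomial x^2 and permanental nullity 2. *)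

theory Defs
  imports
    Complex_Main
    "HOL-Combinatorics.Permutations"
    "HOL-Computational_Algebra.Polynomial"
begin

text \<open>A graph is a pair of a vertex set and an edge set, an edge being a set of two vertices.\<close>

type_synonym 'a graph = "'a set \<times> 'a set set"

definition verts :: "'a graph \<Rightarrow> 'a set" where
  "verts G = fst G"

definition edges :: "'a graph \<Rightarrow> 'a set set" where
  "edges G = snd G"

definition finite_simple_graph :: "'a graph \<Rightarrow> bool" where
  "finite_simple_graph G \<longleftrightarrow>
     finite (verts G) \<and> (\<forall>e\<in>edges G. e \<subseteq> verts G \<and> card e = 2)"

text \<open>
  Connectedness is needed in the theorem: the permanental polynomial is multiplicative over
  connected components, so permanental nullities add up; the line graph of two disjoint edges
  has permanental polynomial x^2 and permanental nullity 2.
  The graph without vertices counts as connected.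
\<close>

definition connected_graph :: "'a graph \<Rightarrow> bool" where
  "connected_graph G \<longleftrightarrow>
     (\<forall>u\<in>verts G. \<forall>v\<in>verts G. (u, v) \<in> {(x, y). {x, y} \<in> edges G}\<^sup>*)"

definition line_graph :: "'a graph \<Rightarrow> 'a set graph" where
  "line_graph G =
     (edges G, {{e, f} | e f. e \<in> edges G \<and> f \<in> edges G \<and> e \<noteq> f \<and> e \<inter> f \<noteq> {}})"

text \<open>
  Rows and columns of the matrices below are indexed by a finite set (here the vertex set)
  instead of the numbers 1 to n: a permanent does not change when rows and columns are
  permuted simultaneously, so no enumeration of the vertices has to be chosen.
\<close>

definition permanent :: "'i set \<Rightarrow> ('i \<Rightarrow> 'i \<Rightarrow> 'c::comm_ring_1) \<Rightarrow> 'c" where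
  "permanent S A = (\<Sum>\<sigma> | \<sigma> permutes S. \<Prod>i\<in>S. A i (\<sigma> i))"

definition adjacency_matrix :: "'a graph \<Rightarrow> 'a \<Rightarrow> 'a \<Rightarrow> real" where
  "adjacency_matrix H u v = (if {u, v} \<in> edges H then 1 else 0)"

definition permanental_poly :: "'a graph \<Rightarrow> real poly" where
  "permanental_poly H =
     permanent (verts H) (\<lambda>u v. (if u = v then [:0, 1:] else 0) - [:adjacency_matrix H u v:])"

text \<open>
  The permanental polynomial of a finite simple graph is monic (lemma \<open>permanental_poly_monic\<close>
  below), in particular nonzero, so \<^const>\<open>order\<close> is the root multiplicity.
\<close>

definition per_nullity :: "'a graph \<Rightarrow> nat" where
  "per_nullity H = order 0 (permanental_poly H)"

lemma finite_edges: "finite_simple_graph G \<Longrightarrow> finite (edges G)"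
  by (rule finite_subset[of _ "Pow (verts G)"]) (auto simp: finite_simple_graph_def)

lemma finite_simple_graph_line_graph:
  assumes "finite_simple_graph G"
  shows "finite_simple_graph (line_graph G)"
  using finite_edges[OF assms]
  by (auto simp: finite_simple_graph_def line_graph_def verts_def edges_def card_2_iff)

lemma permanental_poly_monic:
  assumes "finite_simple_graph H"
  shows "degree (permanental_poly H) = card (verts H)" "lead_coeff (permanental_poly H) = 1"
proof -
  define V where "V = verts H"
  define M :: "'a \<Rightarrow> 'a \<Rightarrow> real poly" where
    "M u v = (if u = v then [:0, 1:] else 0) - [:adjacency_matrix H u v:]" for u v
  have fin: "finite V" using assms by (simp add: finite_simple_graph_def V_def)
  have diag: "M u u = [:0, 1:]" for u
    using assms by (force simp: M_def adjacency_matrix_def finite_simple_graph_def)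
  have deg_off: "degree (M u v) = 0" if "u \<noteq> v" for u v
    using that by (simp add: M_def)
  have small: "degree (\<Prod>i\<in>V. M i (\<sigma> i)) < card V" if perm: "\<sigma> permutes V" and nid: "\<sigma> \<noteq> id" for \<sigma>
  proof -
    obtain u where u: "\<sigma> u \<noteq> u" using nid by fastforce
    have "u \<in> V" using u perm by (auto simp: permutes_def)
    have "degree (\<Prod>i\<in>V. M i (\<sigma> i)) \<le> (\<Sum>i\<in>V. degree (M i (\<sigma> i)))"
      using degree_prod_sum_le[OF fin] by (simp add: comp_def)
    also have "\<dots> < (\<Sum>i\<in>V. 1)"
    proof (rule sum_strict_mono_ex1)
      show "\<forall>i\<in>V. degree (M i (\<sigma> i)) \<le> 1"
      proof
        fix i show "degree (M i (\<sigma> i)) \<le> 1"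
          by (cases "\<sigma> i = i") (simp_all add: diag deg_off)
      qed
      have "degree (M u (\<sigma> u)) = 0" using u deg_off by metis
      then show "\<exists>i\<in>V. degree (M i (\<sigma> i)) < 1"
        using \<open>u \<in> V\<close> by auto
    qed (rule fin)
    finally show ?thesis by simp
  qed
  define R where "R = (\<Sum>\<sigma>\<in>{\<sigma>. \<sigma> permutes V} - {id}. \<Prod>i\<in>V. M i (\<sigma> i))"
  have "permanental_poly H = (\<Sum>\<sigma> | \<sigma> permutes V. \<Prod>i\<in>V. M i (\<sigma> i))"
    by (simp add: permanental_poly_def permanent_def V_def M_def)
  also have "\<dots> = (\<Prod>i\<in>V. M i (id i)) + R"
    unfolding R_def
    by (rule sum.remove[OF finite_permutations[OF fin]]) (use permutes_id in blast)
  also have "(\<Prod>i\<in>V. M i (id i)) = monom 1 (card V)"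
    by (simp add: diag monom_altdef)
  finally have eq: "permanental_poly H = monom 1 (card V) + R" .
  have coeff_R: "coeff R k = 0" if "k \<ge> card V" for k
    unfolding R_def coeff_sum
    using small that by (intro sum.neutral) (auto intro!: coeff_eq_0 intro: less_le_trans)
  have top: "coeff (permanental_poly H) (card V) = 1"
    by (simp add: eq coeff_R)
  have "degree (permanental_poly H) \<le> card V"
    by (rule degree_le) (simp add: eq coeff_R)
  moreover have "card V \<le> degree (permanental_poly H)"
    by (rule le_degree) (simp add: top)
  ultimately show "degree (permanental_poly H) = card (verts H)"
    by (simp add: V_def)
  with top show "lead_coeff (permanental_poly H) = 1" by (simp add: V_def)
qed

end

theory Submission
  imports Defs
begin

text \<open>
  Expanding \<open>per (x I - A(H))\<close> over permutations, a permutation \<open>\<sigma>\<close> with \<open>k\<close> fixed points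
  contributes to the coefficient of \<open>x ^ k\<close> only, and its contribution is \<open>(-1) ^ (n - k)\<close> if \<open>\<sigma>\<close>
  moves every non-fixed vertex to a neighbour, and \<open>0\<close> otherwise. Unlike for the determinant, all
  contributions to a coefficient have the same sign, so nothing cancels. Hence the permanental
  nullity of \<open>H\<close> is at most the number of fixed points of any permutation that moves vertices to
  neighbours only (\<open>per_nullity_le_fixed_points\<close>). It remains to find such a permutation of the
  edges of \<open>G\<close> with at most one fixed point; a near-perfect matching of the line graph will do.

  To get it, orient \<open>G\<close>, that is, assign each edge to one of its endpoints. The edges assigned to
  the same vertex are pairwise adjacent in the line graph, so they can be paired up arbitrarily,
  leaving one edge over at each vertex to which an odd number of edges is assigned
  (\<open>permutes_pairing_within_fibres\<close>). Reassigning the edges along a walk from \<open>u\<close> to \<open>v\<close>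
  changes the parity at \<open>u\<close> and \<open>v\<close> and nowhere else (\<open>flip_walk\<close>). As \<open>G\<close> is connected, odd
  vertices can therefore be eliminated two at a time until at most one is left
  (\<open>ex_orientation_at_most_one_odd\<close>).
\<close>

definition odd_fibres :: "'e set \<Rightarrow> ('e \<Rightarrow> 'v) \<Rightarrow> 'v set" where
  "odd_fibres E h = {v. odd (card {e\<in>E. h e = v})}"

lemma odd_fibresD:
  assumes "v \<in> odd_fibres E h"
  obtains e where "e \<in> E" "h e = v"
proof -
  have "{e\<in>E. h e = v} \<noteq> {}"
    using assms unfolding odd_fibres_def by (metis (lifting) card.empty even_zero mem_Collect_eq)
  with that show thesis by blast
qed

lemma odd_fibres_insert:
  assumes "finite E" "e \<notin> E"
  shows "v \<in> odd_fibres (insert e E) h \<longleftrightarrow> (v \<in> odd_fibres E h) \<noteq> (h e = v)"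
proof -
  have "{e'\<in>insert e E. h e' = v} =
      (if h e = v then insert e {e'\<in>E. h e' = v} else {e'\<in>E. h e' = v})"
    by auto
  with assms show ?thesis by (simp add: odd_fibres_def)
qed

lemma odd_fibres_cong: "(\<And>e. e \<in> E \<Longrightarrow> h e = h' e) \<Longrightarrow> odd_fibres E h = odd_fibres E h'"
  by (simp add: odd_fibres_def cong: conj_cong)

text \<open>
  Two elements of a common fibre can be swapped and removed, which keeps all parities. When no such
  two are left, every nonempty fibre is a single element and hence odd.
\<close>

lemma permutes_pairing_within_fibres:
  assumes "finite E" "\<forall>u\<in>odd_fibres E h. \<forall>v\<in>odd_fibres E h. u = v"
  obtains \<sigma> where "\<sigma> permutes E" "\<forall>e\<in>E. h (\<sigma> e) = h e" "card {e\<in>E. \<sigma> e = e} \<le> 1"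
proof -
  have "\<exists>\<sigma>. \<sigma> permutes E \<and> (\<forall>e\<in>E. h (\<sigma> e) = h e) \<and> card {e\<in>E. \<sigma> e = e} \<le> 1"
    using assms
  proof (induction E rule: finite_psubset_induct)
    case (psubset E)
    show ?case
    proof (cases "inj_on h E")
      case True
      have "e \<in> E \<Longrightarrow> h e \<in> odd_fibres E h" for e
      proof -
        assume "e \<in> E"
        then have "{e'\<in>E. h e' = h e} = {e}" using True by (auto dest: inj_onD)
        then show ?thesis by (simp add: odd_fibres_def)
      qed
      then have "\<forall>e\<in>E. \<forall>f\<in>E. e = f"
        using psubset.prems True by (meson inj_onD)
      then have "card E \<le> 1"
        using card_le_Suc0_iff_eq[OF psubset.hyps] by simp
      then show ?thesis by (intro exI[of _ id] conjI permutes_id) auto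
    next
      case False
      then obtain e f where ef: "e \<in> E" "f \<in> E" "e \<noteq> f" "h e = h f"
        by (auto simp: inj_on_def)
      define F where "F = E - {e, f}"
      have F: "finite F" "e \<notin> F" "f \<notin> F" "E = insert e (insert f F)" "F \<subset> E"
        using ef psubset.hyps by (auto simp: F_def)
      have "odd_fibres E h = odd_fibres F h"
        using F ef by (auto simp: odd_fibres_insert)
      then obtain \<sigma> where \<sigma>: "\<sigma> permutes F" "\<forall>e\<in>F. h (\<sigma> e) = h e" "card {e\<in>F. \<sigma> e = e} \<le> 1"
        using psubset.IH[OF \<open>F \<subset> E\<close>] psubset.prems by metis
      define \<tau> where "\<tau> = transpose e f \<circ> \<sigma>"
      have \<tau>F: "\<tau> x = \<sigma> x" if "x \<in> F" for x
        using that permutes_in_image[OF \<sigma>(1), of x] F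
        by (auto simp: \<tau>_def transpose_def)
      have \<tau>ef: "\<tau> e = f" "\<tau> f = e"
        using permutes_not_in[OF \<sigma>(1)] F by (simp_all add: \<tau>_def)
      have "\<tau> permutes E" unfolding \<tau>_def
        using \<sigma>(1) ef F by (intro permutes_compose permutes_swap_id) (auto intro: permutes_subset)
      moreover have "{x\<in>E. \<tau> x = x} = {x\<in>F. \<sigma> x = x}"
        using F \<tau>F \<tau>ef ef by auto
      moreover have "\<forall>x\<in>E. h (\<tau> x) = h x"
        using F \<tau>F \<tau>ef ef \<sigma>(2) by auto
      ultimately show ?thesis using \<sigma>(3) by auto
    qed
  qed
  with that show thesis by blast
qed

lemma flip_edge:
  assumes "finite E" "{x, y} \<in> E" "x \<noteq> y" "\<forall>e\<in>E. h e \<in> e"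
  shows "\<exists>h'. (\<forall>e\<in>E. h' e \<in> e) \<and>
    (\<forall>w. w \<in> odd_fibres E h' \<longleftrightarrow> (w \<in> odd_fibres E h) \<noteq> ((w = x) \<noteq> (w = y)))"
proof -
  define e where "e = {x, y}"
  define F where "F = E - {e}"
  have F: "finite F" "e \<notin> F" "E = insert e F"
    using assms by (auto simp: F_def e_def)
  have he: "h e = x \<or> h e = y" using assms by (auto simp: e_def)
  define h' where "h' = h(e := if h e = x then y else x)"
  have "\<forall>e\<in>E. h' e \<in> e" using assms by (auto simp: h'_def e_def)
  moreover have "odd_fibres F h' = odd_fibres F h"
    using F by (intro odd_fibres_cong) (auto simp: h'_def)
  then have "w \<in> odd_fibres E h' \<longleftrightarrow> (w \<in> odd_fibres E h) \<noteq> ((h e = w) \<noteq> (h' e = w))" for w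
    unfolding F(3) odd_fibres_insert[OF F(1,2)] by blast
  moreover have "(h e = w) \<noteq> (h' e = w) \<longleftrightarrow> (w = x) \<noteq> (w = y)" for w
    using he \<open>x \<noteq> y\<close> by (auto simp: h'_def)
  ultimately show ?thesis by (intro exI[of _ h'] conjI allI) (assumption, simp only:)
qed

text \<open>
  The interior vertices of the walk are toggled once by each of two consecutive steps. The walk may
  repeat edges, since parities only add up. For \<open>u = v\<close> nothing changes, whence the inequality of
  truth values instead of a disjunction.
\<close>

lemma flip_walk:
  assumes "finite E" "\<forall>e\<in>E. card e = 2" "(u, v) \<in> {(x, y). {x, y} \<in> E}\<^sup>*" "\<forall>e\<in>E. h e \<in> e"
  shows "\<exists>h'. (\<forall>e\<in>E. h' e \<in> e) \<and>
    (\<forall>w. w \<in> odd_fibres E h' \<longleftrightarrow> (w \<in> odd_fibres E h) \<noteq> ((w = u) \<noteq> (w = v)))"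
  using assms(3)
proof (induction rule: rtrancl_induct)
  case base
  show ?case using assms(4) by auto
next
  case (step x y)
  then obtain h1 where h1: "\<forall>e\<in>E. h1 e \<in> e"
    "\<And>w. w \<in> odd_fibres E h1 \<longleftrightarrow> (w \<in> odd_fibres E h) \<noteq> ((w = u) \<noteq> (w = x))"
    by blast
  have xy: "{x, y} \<in> E" using step by simp
  with assms(2) have "x \<noteq> y" by fastforce
  obtain h2 where "\<forall>e\<in>E. h2 e \<in> e"
    "\<And>w. w \<in> odd_fibres E h2 \<longleftrightarrow> (w \<in> odd_fibres E h1) \<noteq> ((w = x) \<noteq> (w = y))"
    using flip_edge[OF assms(1) xy \<open>x \<noteq> y\<close> h1(1)] by blast
  with h1(2) show ?case by (intro exI[of _ h2]) auto
qed

text \<open>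
  Take an orientation with as few odd vertices as possible; with two of them, a walk joining them
  would yield a better one.
\<close>

lemma ex_orientation_at_most_one_odd:
  assumes "finite_simple_graph G" "connected_graph G"
  obtains h where "\<forall>e\<in>edges G. h e \<in> e"
    "\<forall>u\<in>odd_fibres (edges G) h. \<forall>v\<in>odd_fibres (edges G) h. u = v"
proof -
  define E where "E = edges G"
  have finE: "finite E" and card2: "\<forall>e\<in>E. card e = 2" and sub: "\<forall>e\<in>E. e \<subseteq> verts G"
    using assms(1) by (simp_all add: E_def finite_edges finite_simple_graph_def)
  have "\<forall>e\<in>E. (SOME x. x \<in> e) \<in> e"
    using card2 by (metis card.empty some_in_eq zero_neq_numeral)
  note minimal = arg_min_nat_lemma[of "\<lambda>h. \<forall>e\<in>E. h e \<in> e", OF this, of "\<lambda>h. card (odd_fibres E h)"]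
  define h where "h = arg_min (\<lambda>h. card (odd_fibres E h)) (\<lambda>h. \<forall>e\<in>E. h e \<in> e)"
  have h: "\<forall>e\<in>E. h e \<in> e"
    and least: "\<And>h'. \<forall>e\<in>E. h' e \<in> e \<Longrightarrow> card (odd_fibres E h) \<le> card (odd_fibres E h')"
    using minimal by (simp_all add: h_def)
  have "u = v" if uv: "u \<in> odd_fibres E h" "v \<in> odd_fibres E h" for u v
  proof (rule ccontr)
    assume "u \<noteq> v"
    have "u \<in> verts G" "v \<in> verts G"
      using uv h sub by (metis odd_fibresD subsetD)+
    then have "(u, v) \<in> {(x, y). {x, y} \<in> E}\<^sup>*"
      using assms(2) by (simp add: connected_graph_def E_def)
    from flip_walk[OF finE card2 this h] obtain h' where h': "\<forall>e\<in>E. h' e \<in> e"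
      "\<forall>w. w \<in> odd_fibres E h' \<longleftrightarrow> (w \<in> odd_fibres E h) \<noteq> ((w = u) \<noteq> (w = v))"
      by blast
    have "odd_fibres E h' \<subset> odd_fibres E h" using h'(2) uv \<open>u \<noteq> v\<close> by blast
    moreover have "odd_fibres E h \<subseteq> h ` E" by (auto elim: odd_fibresD)
    with finE have "finite (odd_fibres E h)" by (meson finite_imageI finite_subset)
    ultimately have "card (odd_fibres E h') < card (odd_fibres E h)"
      by (simp add: psubset_card_mono)
    with least[OF h'(1)] show False by simp
  qed
  with h show thesis unfolding E_def by (intro that[of h]) blast+
qed

lemma order_0_le_if_coeff_nonzero:
  fixes p :: "'a::field poly"
  assumes "coeff p k \<noteq> 0"
  shows "order 0 p \<le> k"
proof (rule ccontr)
  assume "\<not> order 0 p \<le> k"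
  moreover have "monom 1 (order 0 p) dvd p"
    using order_1[of 0 p] by (simp add: monom_altdef)
  ultimately show False using assms by (simp add: monom_1_dvd_iff')
qed

lemma prod_const_poly: "(\<Prod>i\<in>A. [:f i:]) = [:\<Prod>i\<in>A. f i:]"
  for f :: "'i \<Rightarrow> 'c::comm_semiring_1"
  by (induction A rule: infinite_finite_induct) (simp_all add: one_pCons mult.commute)

text \<open>
  With \<open>k\<close> the number of fixed points of \<open>\<sigma>\<close>, the coefficient of \<open>x ^ k\<close> is \<open>(-1) ^ (n - k)\<close> times a
  sum of nonnegative weights \<open>W \<tau>\<close>, one of which is \<open>W \<sigma> = 1\<close>.
\<close>

lemma per_nullity_le_fixed_points:
  assumes "finite_simple_graph H" "\<sigma> permutes verts H"
    and adj: "\<And>v. v \<in> verts H \<Longrightarrow> \<sigma> v \<noteq> v \<Longrightarrow> {v, \<sigma> v} \<in> edges H"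
  shows "per_nullity H \<le> card {v\<in>verts H. \<sigma> v = v}"
proof -
  define V where "V = verts H"
  define M :: "'a \<Rightarrow> 'a \<Rightarrow> real poly" where
    "M u v = (if u = v then [:0, 1:] else 0) - [:adjacency_matrix H u v:]" for u v
  define k where "k = card {v\<in>V. \<sigma> v = v}"
  have fin: "finite V" using assms by (simp add: finite_simple_graph_def V_def)
  have diag: "M u u = monom 1 1" for u
    using assms by (force simp: M_def adjacency_matrix_def finite_simple_graph_def monom_altdef)
  have off: "M u v = monom (- adjacency_matrix H u v) 0" if "u \<noteq> v" for u v
    using that by (simp add: M_def monom_0)
  define W where "W \<tau> = (\<Prod>v\<in>{v\<in>V. \<tau> v \<noteq> v}. adjacency_matrix H v (\<tau> v))" for \<tau>
  have coeff_prod: "coeff (\<Prod>v\<in>V. M v (\<tau> v)) k =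
      (if card {v\<in>V. \<tau> v = v} = k then (-1) ^ (card V - k) * W \<tau> else 0)" for \<tau>
  proof -
    have V: "V = {v\<in>V. \<tau> v = v} \<union> {v\<in>V. \<tau> v \<noteq> v}" by blast
    have card: "card {v\<in>V. \<tau> v \<noteq> v} = card V - card {v\<in>V. \<tau> v = v}"
      using fin card_Diff_subset[of "{v\<in>V. \<tau> v = v}" V]
      by (simp add: set_diff_eq cong: conj_cong)
    have "(\<Prod>v\<in>V. M v (\<tau> v)) = (\<Prod>v\<in>{v\<in>V. \<tau> v = v}. M v (\<tau> v)) * (\<Prod>v\<in>{v\<in>V. \<tau> v \<noteq> v}. M v (\<tau> v))"
      by (subst V, rule prod.union_disjoint) (use fin in auto)
    also have "(\<Prod>v\<in>{v\<in>V. \<tau> v = v}. M v (\<tau> v)) = monom 1 (card {v\<in>V. \<tau> v = v})"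
      by (simp add: diag monom_power)
    also have "(\<Prod>v\<in>{v\<in>V. \<tau> v \<noteq> v}. M v (\<tau> v)) =
        (\<Prod>v\<in>{v\<in>V. \<tau> v \<noteq> v}. [:- adjacency_matrix H v (\<tau> v):])"
      by (intro prod.cong) (auto simp: off monom_0)
    also have "\<dots> = [:\<Prod>v\<in>{v\<in>V. \<tau> v \<noteq> v}. - adjacency_matrix H v (\<tau> v):]"
      by (rule prod_const_poly)
    also have "\<dots> = monom ((-1) ^ (card V - card {v\<in>V. \<tau> v = v}) * W \<tau>) 0"
      by (simp add: prod_uminus W_def card monom_0)
    finally show ?thesis by (simp add: mult_monom)
  qed
  define T where "T = {\<tau>. \<tau> permutes V \<and> card {v\<in>V. \<tau> v = v} = k}"
  have finT: "finite T" and "\<sigma> \<in> T"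
    using finite_permutations[OF fin] assms(2) by (auto simp: T_def V_def k_def)
  have "coeff (permanental_poly H) k = (\<Sum>\<tau> | \<tau> permutes V. coeff (\<Prod>v\<in>V. M v (\<tau> v)) k)"
    by (simp add: permanental_poly_def permanent_def V_def M_def coeff_sum)
  also have "\<dots> = (\<Sum>\<tau>\<in>T. (-1) ^ (card V - k) * W \<tau>)"
    unfolding coeff_prod using finite_permutations[OF fin]
    by (simp add: T_def sum.inter_filter[symmetric])
  also have "\<dots> = (-1) ^ (card V - k) * (\<Sum>\<tau>\<in>T. W \<tau>)"
    by (simp add: sum_distrib_left)
  finally have coeff: "coeff (permanental_poly H) k = (-1) ^ (card V - k) * (\<Sum>\<tau>\<in>T. W \<tau>)" .
  have "W \<sigma> = 1"
    using adj by (auto simp: W_def V_def adjacency_matrix_def intro!: prod.neutral)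
  moreover have "W \<tau> \<ge> 0" for \<tau>
    by (auto simp: W_def adjacency_matrix_def intro!: prod_nonneg)
  ultimately have "(\<Sum>\<tau>\<in>T. W \<tau>) > 0"
    using finT \<open>\<sigma> \<in> T\<close> by (intro sum_pos2[of _ \<sigma>]) auto
  then have "coeff (permanental_poly H) k \<noteq> 0" by (simp add: coeff)
  then show ?thesis
    unfolding per_nullity_def k_def V_def by (rule order_0_le_if_coeff_nonzero)
qed

theorem theorem5p3:
  fixes G :: "'a graph"
  assumes "finite_simple_graph G"
    and "connected_graph G"
  shows "per_nullity (line_graph G) = 0 \<or> per_nullity (line_graph G) = 1"
proof -
  obtain h where h: "\<forall>e\<in>edges G. h e \<in> e"
    "\<forall>u\<in>odd_fibres (edges G) h. \<forall>v\<in>odd_fibres (edges G) h. u = v"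
    using ex_orientation_at_most_one_odd[OF assms] by blast
  obtain \<sigma> where \<sigma>: "\<sigma> permutes edges G" "\<forall>e\<in>edges G. h (\<sigma> e) = h e"
    "card {e\<in>edges G. \<sigma> e = e} \<le> 1"
    using permutes_pairing_within_fibres[OF finite_edges[OF assms(1)] h(2)] by blast
  have verts: "verts (line_graph G) = edges G" by (simp add: line_graph_def verts_def)
  have "{e, \<sigma> e} \<in> edges (line_graph G)" if "e \<in> edges G" "\<sigma> e \<noteq> e" for e
  proof -
    have "\<sigma> e \<in> edges G" using that \<sigma>(1) by (simp add: permutes_in_image)
    \<comment> \<open>An edge and its image are assigned to the same vertex, which is thus a common endpoint.\<close>
    moreover from this have "h e \<in> e \<inter> \<sigma> e" using that h(1) \<sigma>(2) by fastforce
    ultimately show ?thesis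
      using that unfolding line_graph_def edges_def snd_conv by blast
  qed
  then have "per_nullity (line_graph G) \<le> card {e\<in>edges G. \<sigma> e = e}"
    using per_nullity_le_fixed_points[OF finite_simple_graph_line_graph[OF assms(1)]] \<sigma>(1)
    by (simp add: verts)
  with \<sigma>(3) show ?thesis by linarith
qed

end
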